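(* Let $|\alpha|<\pi/2$, $0\le\beta<1$, $m>1$ and $0\le q<1$ ($q\neq0$ being implicit, since the condition below divides by $q$). Let $\tau\in\mathbb{C}\setminus\{0\}$ and $-1\le B<A\le1$. If $f\in\mathcal{R}^\tau(A,B)$, then $\mathcal{I}_q^mf\in\mathcal{TSP}_p(\alpha,\beta)$ if $$(A-B)|\tau|\left[2\left[1-(1-q)^m\right]-\frac{\cos\alpha+\beta}{q(m-1)}\left[(1-q)-(1-q)^m-q(m-1)(1-q)^m\right]\right]\le\cos\alpha-\beta.$$
   Context: $\mathbb{U}=\{z\in\mathbb{C}:|z|<1\}$. $\mathcal{A}$ is the class of functions $f(z)=z+\sum_{n=2}^\infty a_nz^n$ analytic in $\mathbb{U}$ (so $f(0)=0$, $f'(0)=1$). $\mathcal{T}$ is the subclass of $\mathcal{A}$ of functions of the form $f(z)=z-\sum_{n=2}^\infty|a_n|z^n$, $z\in\mathbb{U}$. For $|\alpha|<\pi/2$ and $0\le\beta<1$, $\mathcal{SP}_p(\alpha,\beta)$ is the class of $f\in\mathcal{A}$ such that for all $z\in\mathbb{U}$ $$\operatorname{Re}\left\{e^{-i\alpha}\frac{zf'(z)}{f(z)}\right\}>\left|\frac{zf'(z)}{f(z)}-1\right|+\beta$$ (the quotient $zf'(z)/f(z)$ being read as $1$ at $z=0$). $\mathcal{TSP}_p(\alpha,\beta)=\mathcal{SP}_p(\alpha,\beta)\cap\mathcal{T}$. For $\tau\in\mathbb{C}\setminus\{0\}$ and $-1\le B<A\le1$, $\mathcal{R}^\tau(A,B)$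 is the class of $f\in\mathcal{A}$ with $$\left|\frac{f'(z)-1}{(A-B)\tau-B[f'(z)-1]}\right|<1,\quad z\in\mathbb{U}.$$ For $f(z)=z+\sum_{n=2}^\infty a_nz^n\in\mathcal{A}$, the linear operator $\mathcal{I}_q^m:\mathcal{A}\to\mathcal{A}$ is $$\mathcal{I}_q^mf(z)=z+\sum_{n=2}^\infty\binom{n+m-2}{m-1}q^{n-1}(1-q)^ma_nz^n,\quad z\in\mathbb{U},$$ where $\binom{n+m-2}{m-1}=\frac{m(m+1)\cdots(m+n-2)}{(n-1)!}$.
   Formalization: As stated the claim fails (f=z+z²/8, α=β=0, m=2, q=1/2, A=1, B=0, τ=1/2: the image is not in 𝒯); proved instead: I_q^m f ∈ SP_p(α,β) for every f ∈ R^τ(A,B), and I_q^m f ∈ TSP_p(α,β) when also f ∈ 𝒯. *)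

theory Defs
  imports "HOL-Complex_Analysis.Complex_Analysis"
begin

text \<open>
  The unit disc is \<open>ball 0 1\<close>. Functions are total on \<open>complex\<close>, but every notion below only
  constrains their values on the disc.
\<close>

definition class_A :: "(complex \<Rightarrow> complex) set" where
  "class_A = {f. f holomorphic_on ball 0 1 \<and> f 0 = 0 \<and> deriv f 0 = 1}"

definition class_T :: "(complex \<Rightarrow> complex) set" where
  "class_T = {f \<in> class_A. \<exists>a :: nat \<Rightarrow> complex. \<forall>z \<in> ball 0 1.
     (\<lambda>n. of_real (norm (a (n + 2))) * z ^ (n + 2)) sums (z - f z)}"

definition log_quot :: "(complex \<Rightarrow> complex) \<Rightarrow> complex \<Rightarrow> complex" where
  "log_quot f z = (if z = 0 then 1 else z * deriv f z / f z)"

text \<open>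
  At a zero \<open>z \<noteq> 0\<close> of \<open>f\<close> the quotient is \<open>0\<close> by the convention for division by zero. The
  inequality below would then read \<open>0 > 1 + \<beta>\<close>, so for \<open>\<beta> \<ge> 0\<close> members of the class have no
  zero in the disc other than the origin.
\<close>

definition SP_p :: "real \<Rightarrow> real \<Rightarrow> (complex \<Rightarrow> complex) set" where
  "SP_p \<alpha> \<beta> = {f \<in> class_A. \<forall>z \<in> ball 0 1.
     Re (exp (- (\<i> * of_real \<alpha>)) * log_quot f z) > norm (log_quot f z - 1) + \<beta>}"

definition TSP_p :: "real \<Rightarrow> real \<Rightarrow> (complex \<Rightarrow> complex) set" where
  "TSP_p \<alpha> \<beta> = SP_p \<alpha> \<beta> \<inter> class_T"

text \<open>
  The denominator is required to be nonzero explicitly, since a pole of the quotient would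
  otherwise satisfy the bound by the convention for division by zero.
\<close>

definition class_R :: "complex \<Rightarrow> real \<Rightarrow> real \<Rightarrow> (complex \<Rightarrow> complex) set" where
  "class_R \<tau> A B = {f \<in> class_A. \<forall>z \<in> ball 0 1.
     of_real (A - B) * \<tau> - of_real B * (deriv f z - 1) \<noteq> 0 \<and>
     norm ((deriv f z - 1) / (of_real (A - B) * \<tau> - of_real B * (deriv f z - 1))) < 1}"

text \<open>
  \<open>pascal_binom m n\<close> is $\binom{n+m-2}{m-1} = m(m+1)\cdots(m+n-2)/(n-1)!$ for \<open>n \<ge> 1\<close>;
  the product formula gives it a meaning for real \<open>m\<close>.
\<close>

definition pascal_binom :: "real \<Rightarrow> nat \<Rightarrow> real" where
  "pascal_binom m n = pochhammer m (n - 1) / fact (n - 1)"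

text \<open>
  The summation index is shifted by \<open>2\<close>; \<open>fps_nth (fps_expansion f 0) n\<close> is the \<open>n\<close>-th Taylor
  coefficient of \<open>f\<close> at the origin. All multipliers are positive for \<open>m > 0\<close> and \<open>0 < q < 1\<close>,
  so the operator preserves the signs of the coefficients: on \<open>class_A\<close> its values lie in
  \<open>class_T\<close> exactly when its argument does.
\<close>

definition pascal_op :: "real \<Rightarrow> real \<Rightarrow> (complex \<Rightarrow> complex) \<Rightarrow> complex \<Rightarrow> complex" where
  "pascal_op q m f z = z + (\<Sum>n. of_real (pascal_binom m (n + 2) * q ^ (n + 1) * (1 - q) powr m) *
     fps_nth (fps_expansion f 0) (n + 2) * z ^ (n + 2))"

end

theory Submission
  imports Defs
begin

text \<open>
  A function \<open>f\<close> in \<open>class_R \<tau> A B\<close> has \<open>n\<close>-th Taylor coefficient at most \<open>(A - B) |\<tau>| / n\<close>,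
  because \<open>h = (f' - 1) / ((A - B) \<tau>)\<close> satisfies \<open>|h| < |1 - B h|\<close>, a convex condition. On the
  other hand, a function with coefficients \<open>b n\<close> is in \<open>SP_p \<alpha> \<beta>\<close> as soon as
  \<open>\<Sum> (2 n - cos \<alpha> - \<beta>) |b n| \<le> cos \<alpha> - \<beta>\<close>. Inserting the coefficient bound, the sum is
  evaluated in closed form by the negative binomial series and is the left-hand side of the
  hypothesis. As that sum is positive, the hypothesis also forces \<open>\<beta> < cos \<alpha>\<close>.
\<close>

section \<open>Coefficient bounds for \<open>class_R\<close>\<close>

text \<open>Cauchy's inequality needs \<open>w\<close> on a closed disc, so it is applied at radius
  \<open>r < 1\<close>, which bounds the coefficient by \<open>1 / r ^ n\<close>; then
  \<open>r\<close> tends to 1 from the left.\<close>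

lemma norm_fps_expansion_le_one:
  assumes holo: "w holomorphic_on ball 0 1"
    and bound: "\<And>z. z \<in> ball 0 1 \<Longrightarrow> norm (w z) \<le> 1"
  shows "norm (fps_nth (fps_expansion w 0) n) \<le> 1"
proof -
  let ?c = "norm (fps_nth (fps_expansion w 0) n)"
  have *: "?c * r ^ n \<le> 1" if r: "0 < r" "r < 1" for r :: real
  proof -
    have "norm ((deriv ^^ n) w 0) \<le> fact n * 1 / r ^ n"
    proof (rule Cauchy_inequality)
      show "w holomorphic_on ball 0 r" "continuous_on (cball 0 r) w"
        using r by (auto intro!: holomorphic_on_imp_continuous_on holomorphic_on_subset[OF holo])
    qed (use r bound in \<open>auto simp: dist_norm\<close>)
    then show ?thesis
      using r by (simp add: fps_expansion_def norm_divide field_simps)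
  qed
  have "((\<lambda>r. ?c * r ^ n) \<longlongrightarrow> ?c * 1 ^ n) (at_left (1::real))"
    by (intro tendsto_intros)
  moreover have "\<forall>\<^sub>F r in at_left (1::real). ?c * r ^ n \<le> 1"
    using eventually_at_left_real[of 0 "1::real"] by (auto elim!: eventually_mono intro: *)
  ultimately have "?c * 1 ^ n \<le> 1"
    by (rule tendsto_upperbound) simp
  then show ?thesis by simp
qed

text \<open>Squaring turns the condition into \<open>(1 - B^2) |x|^2 + 2 B Re x < 1\<close>. For
  \<open>B^2 = 1\<close> this is an open half-plane; otherwise completing the square gives the open
  disc with centre \<open>- B / (1 - B^2)\<close> and radius \<open>1 / (1 - B^2)\<close>.\<close>

lemma convex_norm_less_norm_one_minus:
  fixes B :: real
  assumes "\<bar>B\<bar> \<le> 1"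
  shows "convex {x :: complex. norm x < norm (1 - of_real B * x)}"
proof -
  have expand: "norm x < norm (1 - of_real B * x) \<longleftrightarrow>
      (1 - B\<^sup>2) * ((Re x)\<^sup>2 + (Im x)\<^sup>2) + 2 * B * Re x < 1" for x :: complex
  proof -
    have "norm x < norm (1 - of_real B * x) \<longleftrightarrow> (norm x)\<^sup>2 < (norm (1 - of_real B * x))\<^sup>2"
      by (simp add: power_mono_iff flip: not_le)
    then show ?thesis
      by (simp only: cmod_power2) (simp add: power2_eq_square algebra_simps)
  qed
  show ?thesis
  proof (cases "B\<^sup>2 = 1")
    case True
    have "{x :: complex. norm x < norm (1 - of_real B * x)} = {x. inner (of_real (2 * B)) x < 1}"
      by (auto simp: expand True inner_complex_def)
    then show ?thesis by (simp only: convex_halfspace_lt)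
  next
    case False
    define s where "s = 1 - B\<^sup>2"
    have s: "s > 0"
      using False assms by (simp add: s_def abs_square_less_1 abs_square_le_1 order_less_le)
    have "{x :: complex. norm x < norm (1 - of_real B * x)} = ball (of_real (- B / s)) (1 / s)"
    proof -
      have "norm x < norm (1 - of_real B * x) \<longleftrightarrow> dist (of_real (- B / s)) x < 1 / s" for x :: complex
      proof -
        have "dist (of_real (- B / s)) x < 1 / s \<longleftrightarrow> (dist (of_real (- B / s)) x)\<^sup>2 < (1 / s)\<^sup>2"
          using s by (simp add: power_mono_iff flip: not_le)
        also have "(dist (of_real (- B / s)) x)\<^sup>2 = (- B / s - Re x)\<^sup>2 + (Im x)\<^sup>2"
          by (simp add: dist_norm cmod_power2)
        also have "\<dots> < (1 / s)\<^sup>2 \<longleftrightarrow> s\<^sup>2 * ((- B / s - Re x)\<^sup>2 + (Im x)\<^sup>2) < 1"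
          using s by (simp add: power_divide field_simps)
        also have "s\<^sup>2 * ((- B / s - Re x)\<^sup>2 + (Im x)\<^sup>2)
            = s * (s * ((Re x)\<^sup>2 + (Im x)\<^sup>2) + 2 * B * Re x) + B\<^sup>2"
          using s by (simp add: field_simps power2_eq_square)
        also have "\<dots> < 1 \<longleftrightarrow> s * (s * ((Re x)\<^sup>2 + (Im x)\<^sup>2) + 2 * B * Re x) < s * 1"
          by (auto simp: s_def)
        also have "\<dots> \<longleftrightarrow> s * ((Re x)\<^sup>2 + (Im x)\<^sup>2) + 2 * B * Re x < 1"
          using s by (simp only: mult_less_cancel_left_pos)
        finally show ?thesis by (simp only: expand s_def)
      qed
      then show ?thesis by (simp only: ball_def)
    qed
    then show ?thesis by (simp only: convex_ball)
  qed
qed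

text \<open>Exchanging the roles of \<open>j\<close> and \<open>k\<close> in the exponent makes this
  a geometric sum with ratio \<open>?e\<close>. The ratio is an \<open>n\<close>-th root of unity
  and differs from 1 because \<open>n\<close> does not divide \<open>k\<close>.\<close>

lemma sum_powers_root_of_unity:
  assumes "0 < k" "k < n"
  shows "(\<Sum>j<n. (exp (2 * of_real pi * \<i> * of_nat j / of_nat n)) ^ k) = (0 :: complex)"
proof -
  let ?e = "exp (2 * of_real pi * \<i> * of_nat k / of_nat n)"
  have "?e \<noteq> 1"
    using complex_root_unity_eq_1[of n k] assms by (auto dest: dvd_imp_le)
  have "(\<Sum>j<n. (exp (2 * of_real pi * \<i> * of_nat j / of_nat n)) ^ k) = (\<Sum>j<n. ?e ^ j)"
    by (intro sum.cong refl) (simp add: exp_of_nat_mult[symmetric] mult_ac)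
  also have "\<dots> = (?e ^ n - 1) / (?e - 1)"
    using \<open>?e \<noteq> 1\<close> by (simp add: geometric_sum)
  also have "?e ^ n = 1"
    using complex_root_unity[of n k] assms by simp
  finally show ?thesis by simp
qed

text \<open>
  Rogosinski's argument: averaging over the \<open>n\<close>-th roots of unity keeps the values inside the
  convex region and kills the coefficients of order below \<open>n\<close>.
\<close>

lemma norm_coeff_le_one_of_convex_region:
  fixes B :: real
  assumes holo: "h holomorphic_on ball 0 1" and h0: "h 0 = 0" and B: "\<bar>B\<bar> \<le> 1"
    and region: "\<And>z. z \<in> ball 0 1 \<Longrightarrow> norm (h z) < norm (1 - of_real B * h z)"
    and n: "1 \<le> n"
  shows "norm (fps_nth (fps_expansion h 0) n) \<le> 1"
proof -
  define e where "e j = exp (2 * of_real pi * \<i> * of_nat j / of_nat n)" for j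
  have norm_e: "norm (e j) = 1" for j
    by (simp add: e_def norm_exp_eq_Re)
  define g where "g z = (\<Sum>j<n. (1 / of_nat n) * h (e j * z))" for z
  define H where "H = fps_expansion h 0"
  define G where "G = (\<Sum>j<n. fps_const (1 / of_nat n) * (H oo (fps_const (e j) * fps_X)))"
  have hH: "h has_fps_expansion H"
    unfolding H_def by (rule has_fps_expansion_fps_expansion[of "ball 0 1"]) (use holo in auto)
  have "(\<lambda>z. e j * z) has_fps_expansion fps_const (e j) * fps_X" for j
    by (intro fps_expansion_intros)
  then have "(h \<circ> (\<lambda>z. e j * z)) has_fps_expansion (H oo (fps_const (e j) * fps_X))" for j
    by (intro has_fps_expansion_compose hH) auto
  then have "(\<lambda>z. h (e j * z)) has_fps_expansion (H oo (fps_const (e j) * fps_X))" for j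
    by (simp add: o_def)
  then have gG: "g has_fps_expansion G"
    unfolding g_def G_def by (intro fps_expansion_intros)
  have G_nth: "fps_nth G k = fps_nth H k * ((\<Sum>j<n. e j ^ k) / of_nat n)" for k
    unfolding G_def
    by (simp add: fps_sum_nth fps_compose_linear sum_divide_distrib sum_distrib_left
        mult.commute[of "fps_nth H k"])
  have H0: "fps_nth H 0 = 0"
    by (simp add: H_def fps_expansion_def h0)
  \<comment> \<open>The roots of unity remove the coefficients with \<open>0 < k < n\<close>, but
    the average preserves the constant term, which vanishes because \<open>h 0 = 0\<close>.\<close>
  have G_low: "fps_nth G k = 0" if "k < n" for k
    using that sum_powers_root_of_unity[of k n] by (cases "k = 0") (auto simp: G_nth H0 e_def)
  have "e j ^ n = 1" for j
    using complex_root_unity[of n j] n by (simp add: e_def)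
  then have G_n: "fps_nth G n = fps_nth H n"
    using n by (simp add: G_nth)
  have g_region: "norm (g z) < norm (1 - of_real B * g z)" if z: "z \<in> ball 0 1" for z
  proof -
    have "(\<Sum>j<n. (1 / real n) *\<^sub>R h (e j * z)) \<in> {x. norm x < norm (1 - of_real B * x)}"
    proof (rule convex_sum)
      show "h (e j * z) \<in> {x. norm x < norm (1 - of_real B * x)}" for j
        using z by (auto intro!: region simp: norm_mult norm_e)
    qed (use n B in \<open>auto intro: convex_norm_less_norm_one_minus\<close>)
    also have "(\<Sum>j<n. (1 / real n) *\<^sub>R h (e j * z)) = g z"
      by (simp add: g_def scaleR_conv_of_real)
    finally show ?thesis by simp
  qed
  then have den: "1 - of_real B * g z \<noteq> 0" if "z \<in> ball 0 1" for z
    using that by force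
  have holo_g: "g holomorphic_on ball 0 1"
    unfolding g_def
    by (intro holomorphic_intros holomorphic_on_compose_gen[OF _ holo, unfolded o_def])
       (auto simp: norm_mult norm_e)
  \<comment> \<open>The region is exactly where \<open>x / (1 - B x)\<close> has modulus below 1
    with nonzero denominator, so \<open>w\<close> is a bounded function to which Cauchy's inequality
    applies. It remains to see that \<open>w\<close> and \<open>g\<close> have the same
    \<open>n\<close>-th coefficient, which is read off from \<open>w - B g w = g\<close>.\<close>
  define w where "w z = g z / (1 - of_real B * g z)" for z
  define W where "W = fps_expansion w 0"
  have holo_w: "w holomorphic_on ball 0 1"
    unfolding w_def using den by (intro holomorphic_intros holo_g)
  have wW: "w has_fps_expansion W"
    unfolding W_def by (rule has_fps_expansion_fps_expansion[of "ball 0 1"]) (use holo_w in auto)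
  have "(\<lambda>z. w z - of_real B * (g z * w z)) has_fps_expansion W - fps_const (of_real B) * (G * W)"
    by (intro fps_expansion_intros gG wW)
  moreover have "\<forall>\<^sub>F z in nhds 0. w z - of_real B * (g z * w z) = g z"
  proof -
    have "\<forall>\<^sub>F z in nhds (0::complex). z \<in> ball 0 1"
      by (rule eventually_nhds_in_open) auto
    then show ?thesis
    proof eventually_elim
      case (elim z)
      have "w z * (1 - of_real B * g z) = g z"
        using den[OF elim] by (simp add: w_def)
      then show ?case by (simp only: right_diff_distrib mult_1_left mult_1_right mult_ac)
    qed
  qed
  ultimately have "g has_fps_expansion W - fps_const (of_real B) * (G * W)"
    by (rule has_fps_expansion_cong[OF _ refl, THEN iffD1, rotated])
  then have "G = W - fps_const (of_real B) * (G * W)"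
    using fps_expansion_unique_complex gG by blast
  then have "fps_nth G n = fps_nth W n - of_real B * fps_nth (G * W) n"
    by (metis fps_sub_nth fps_mult_left_const_nth)
  \<comment> \<open>Here \<open>G\<close> starts at order \<open>n\<close> and \<open>W\<close> has
    no constant term, so the product starts only beyond order \<open>n\<close>.\<close>
  also have "fps_nth (G * W) n = (\<Sum>i=0..n. fps_nth G i * fps_nth W (n - i))"
    by (simp add: fps_mult_nth)
  also have "\<dots> = 0"
  proof (rule sum.neutral, safe)
    fix i assume "i \<in> {0..n}"
    have "w 0 = 0" by (simp add: w_def g_def h0)
    then have "fps_nth W 0 = 0" by (simp add: W_def fps_expansion_def)
    then show "fps_nth G i * fps_nth W (n - i) = 0"
      using \<open>i \<in> {0..n}\<close> G_low by (cases "i = n") auto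
  qed
  finally have "fps_nth H n = fps_nth W n"
    by (simp add: G_n)
  moreover have "norm (fps_nth W n) \<le> 1"
    unfolding W_def
  proof (rule norm_fps_expansion_le_one[OF holo_w])
    show "norm (w z) \<le> 1" if "z \<in> ball 0 1" for z
      using g_region[OF that] den[OF that] by (simp add: w_def norm_divide divide_simps)
  qed
  ultimately show ?thesis by (simp add: H_def)
qed

lemma norm_coeff_class_R:
  assumes \<tau>: "\<tau> \<noteq> 0" and AB: "-1 \<le> B" "B < A" "A \<le> 1" and f: "f \<in> class_R \<tau> A B"
  shows "real (n + 2) * norm (fps_nth (fps_expansion f 0) (n + 2)) \<le> (A - B) * norm \<tau>"
proof -
  define D where "D = of_real (A - B) * \<tau>"
  have D: "D \<noteq> 0" "norm D = (A - B) * norm \<tau>"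
    using \<tau> AB by (simp_all add: D_def norm_mult flip: of_real_diff)
  have holo: "f holomorphic_on ball 0 1" and f1: "deriv f 0 = 1"
    and R: "\<And>z. z \<in> ball 0 1 \<Longrightarrow> D - of_real B * (deriv f z - 1) \<noteq> 0"
      "\<And>z. z \<in> ball 0 1 \<Longrightarrow> norm ((deriv f z - 1) / (D - of_real B * (deriv f z - 1))) < 1"
    using f by (auto simp: class_R_def class_A_def D_def)
  \<comment> \<open>Dividing by \<open>D\<close> removes \<open>\<tau>\<close> and \<open>A\<close>
    from the condition, leaving the region that depends on \<open>B\<close> alone.\<close>
  define h where "h z = (1 / D) * (deriv f z - 1)" for z
  define F where "F = fps_expansion f 0"
  have fF: "f has_fps_expansion F"
    unfolding F_def by (rule has_fps_expansion_fps_expansion[of "ball 0 1"]) (use holo in auto)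
  have "norm (fps_nth (fps_expansion h 0) (n + 1)) \<le> 1"
  proof (rule norm_coeff_le_one_of_convex_region)
    show "h holomorphic_on ball 0 1"
      unfolding h_def by (intro holomorphic_intros holo) auto
    show "norm (h z) < norm (1 - of_real B * h z)" if "z \<in> ball 0 1" for z
    proof -
      have "norm (deriv f z - 1) < norm (D - of_real B * (deriv f z - 1))"
        using R[OF that] by (simp add: norm_divide divide_simps)
      moreover have "deriv f z - 1 = D * h z" "D - of_real B * (deriv f z - 1) = D * (1 - of_real B * h z)"
        using D by (simp_all add: h_def field_simps)
      ultimately show ?thesis using D(1) by (simp add: norm_mult)
    qed
  qed (use AB in \<open>auto simp: h_def f1\<close>)
  \<comment> \<open>Differentiation shifts the index: coefficient \<open>n + 1\<close> of
    \<open>h\<close> is \<open>n + 2\<close> times coefficient \<open>n + 2\<close> of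
    \<open>f\<close>, divided by \<open>D\<close>. Subtracting 1 affects only the constant
    term.\<close>
  moreover have "h has_fps_expansion fps_const (1 / D) * (fps_deriv F - 1)"
    unfolding h_def by (intro fps_expansion_intros fF)
  ultimately have "norm (of_nat (n + 2) * fps_nth F (n + 2) / D) \<le> 1"
    by (simp add: fps_expansion_eqI)
  then have "real (n + 2) * norm (fps_nth F (n + 2)) / norm D \<le> 1"
    by (simp only: norm_mult norm_divide norm_of_nat)
  then show ?thesis
    using D(1) by (simp only: F_def D(2)[symmetric] zero_less_norm_iff pos_divide_le_eq mult_1_left
        not_False_eq_True)
qed


section \<open>Negative binomial series and sums of the Pascal weights\<close>

text \<open>This is the binomial series with exponent \<open>- m\<close> at \<open>- q\<close>; the
  sign in \<open>- m gchoose n\<close> cancels the sign of \<open>(- q) ^ n\<close>.\<close>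

lemma neg_binomial_sums:
  fixes m q :: real
  assumes "\<bar>q\<bar> < 1"
  shows "(\<lambda>n. pochhammer m n / fact n * q ^ n) sums (1 - q) powr (- m)"
proof -
  have "(\<lambda>n. (- m gchoose n) * (- q) ^ n) sums (1 + - q) powr (- m)"
    using assms by (intro gen_binomial_real) auto
  moreover have "(- m gchoose n) * (- q) ^ n = pochhammer m n / fact n * q ^ n" for n
  proof -
    have "(- 1 :: real) ^ n * (- q) ^ n = q ^ n"
      by (simp flip: power_mult_distrib)
    then show ?thesis by (simp add: gbinomial_pochhammer)
  qed
  ultimately show ?thesis by simp
qed

text \<open>Multiplied by \<open>(1 - q) powr m\<close>, the negative binomial series has total 1.
  The weights are its terms from index 1 on, so only the initial term \<open>(1 - q) powr m\<close>
  is lost.\<close>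

lemma pascal_weights_sums:
  assumes "0 < q" "q < 1"
  shows "(\<lambda>n. pascal_binom m (n + 2) * q ^ (n + 1) * (1 - q) powr m) sums (1 - (1 - q) powr m)"
proof -
  have "(\<lambda>n. pochhammer m n / fact n * q ^ n * (1 - q) powr m)
      sums ((1 - q) powr (- m) * (1 - q) powr m)"
    using assms by (intro sums_mult2 neg_binomial_sums) auto
  also have "(1 - q) powr (- m) * (1 - q) powr m = (1 - (1 - q) powr m) + (1 - q) powr m"
    using assms by (simp flip: powr_add)
  finally show ?thesis
    using sums_Suc_iff[of "\<lambda>n. pochhammer m n / fact n * q ^ n * (1 - q) powr m" "1 - (1 - q) powr m"]
    by (simp add: pascal_binom_def)
qed

text \<open>
  Dividing by the index lowers the parameter from \<open>m\<close> to \<open>m - 1\<close>, since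
  \<open>pochhammer (m - 1) (k + 1) = (m - 1) * pochhammer m k\<close>.
\<close>

lemma pascal_weights_div_sums:
  assumes "0 < q" "q < 1" "m \<noteq> 1"
  shows "(\<lambda>n. pascal_binom m (n + 2) * q ^ (n + 1) * (1 - q) powr m / real (n + 2)) sums
    (((1 - q) - (1 - q) powr m - q * (m - 1) * (1 - q) powr m) / (q * (m - 1)))"
proof -
  let ?t = "\<lambda>n. pochhammer (m - 1) n / fact n * q ^ n"
  have "?t sums (1 - q) powr (- (m - 1))"
    using assms by (intro neg_binomial_sums) auto
  \<comment> \<open>The terms 1 and \<open>(m - 1) * q\<close> are split off. The factor introduced
    next cancels the extra \<open>m - 1\<close> from the Pochhammer symbol and one power of
    \<open>q\<close>, while \<open>fact (n + 2)\<close> absorbs the divisor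
    \<open>n + 2\<close>.\<close>
  then have "(\<lambda>n. ?t (n + 2)) sums ((1 - q) powr (- (m - 1)) - (\<Sum>n<2. ?t n))"
    by (rule sums_split_initial_segment)
  then have "(\<lambda>n. ?t (n + 2) * ((1 - q) powr m / (q * (m - 1)))) sums
      (((1 - q) powr (- (m - 1)) - (1 + (m - 1) * q)) * ((1 - q) powr m / (q * (m - 1))))"
    by (intro sums_mult2) (simp add: numeral_2_eq_2)
  moreover have "?t (n + 2) * ((1 - q) powr m / (q * (m - 1)))
      = pascal_binom m (n + 2) * q ^ (n + 1) * (1 - q) powr m / real (n + 2)" for n
  proof -
    have "pochhammer (m - 1) (n + 2) = (m - 1) * pochhammer m (n + 1)"
      using pochhammer_rec[of "m - 1" "n + 1"] by simp
    then show ?thesis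
      using assms by (simp add: pascal_binom_def del: pochhammer_Suc of_nat_Suc of_nat_add)
        (simp add: fact_Suc add.commute mult_ac)
  qed
  moreover have "((1 - q) powr (- (m - 1)) - (1 + (m - 1) * q)) * (1 - q) powr m
      = (1 - q) - (1 - q) powr m - q * (m - 1) * (1 - q) powr m"
  proof -
    have "(1 - q) powr (- (m - 1)) * (1 - q) powr m = 1 - q"
      using assms by (simp flip: powr_add)
    then show ?thesis by (simp add: algebra_simps)
  qed
  ultimately show ?thesis by (simp only: times_divide_eq_right)
qed

section \<open>A sufficient coefficient condition for \<open>SP_p\<close>\<close>

text \<open>Absolute summability of \<open>b\<close> gives convergence throughout the unit disc,
  where a power series may be differentiated termwise. The sequence \<open>c\<close> puts the
  leading coefficients 0 and 1 in front of \<open>b\<close>, so that the whole function is a single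
  power series.\<close>

lemma has_field_derivative_tail_series:
  fixes b :: "nat \<Rightarrow> complex"
  assumes b: "summable (\<lambda>n. norm (b n))" and z: "norm z < 1"
  shows "((\<lambda>z. z + (\<Sum>n. b n * z ^ (n + 2))) has_field_derivative
    (1 + (\<Sum>n. of_nat (n + 2) * b n * z ^ (n + 1)))) (at z)"
proof -
  define c where "c n = (if n < 2 then of_nat n else b (n - 2))" for n
  have summ_c: "summable (\<lambda>n. c n * w ^ n)" if "norm w \<le> 1" for w
  proof -
    have "summable (\<lambda>n. norm (b n * w ^ (n + 2)))"
      by (rule summable_comparison_test[OF _ b])
         (auto intro!: exI[of _ 0] mult_left_le power_le_one simp: norm_mult norm_power that
           simp del: power_Suc)
    then have "summable (\<lambda>n. c (n + 2) * w ^ (n + 2))"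
      by (simp add: c_def summable_norm_cancel)
    then show ?thesis by (subst (asm) summable_iff_shift)
  qed
  have series: "(\<Sum>n. c n * w ^ n) = w + (\<Sum>n. b n * w ^ (n + 2))" if "norm w < 1" for w
    using suminf_split_initial_segment[OF summ_c[of w], of 2] that
    by (simp add: c_def numeral_2_eq_2)
  have "((\<lambda>w. \<Sum>n. c n * w ^ n) has_field_derivative (\<Sum>n. diffs c n * z ^ n)) (at z)"
    using summ_c z by (intro termdiffs_strong'[where K = 1]) auto
  then have "((\<lambda>w. w + (\<Sum>n. b n * w ^ (n + 2))) has_field_derivative (\<Sum>n. diffs c n * z ^ n)) (at z)"
    by (rule has_field_derivative_transform_within_open[of _ _ _ "ball 0 1"])
       (use z series in auto)
  moreover have "(\<Sum>n. diffs c n * z ^ n) = 1 + (\<Sum>n. of_nat (n + 2) * b n * z ^ (n + 1))"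
  proof -
    have "summable (\<lambda>n. diffs c n * z ^ n)"
      using summ_c z by (intro termdiff_converges[of _ 1]) auto
    from suminf_split_initial_segment[OF this, of 1] show ?thesis
      by (simp add: diffs_def c_def numeral_2_eq_2)
  qed
  ultimately show ?thesis by simp
qed

text \<open>
  Since \<open>Re (exp (- \<i> \<alpha>) w) \<ge> cos \<alpha> - |w - 1|\<close>, it is enough to have \<open>2 |w - 1| < cos \<alpha> - \<beta>\<close>
  for the logarithmic quotient \<open>w\<close>.
\<close>

lemma SP_p_of_coeff_sum:
  fixes b :: "nat \<Rightarrow> complex"
  assumes \<beta>: "\<beta> < cos \<alpha>"
    and summ: "summable (\<lambda>n. real (n + 2) * norm (b n))"
    and le: "(\<Sum>n. (2 * real (n + 2) - cos \<alpha> - \<beta>) * norm (b n)) \<le> cos \<alpha> - \<beta>"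
    and g: "\<And>z. g z = z + (\<Sum>n. b n * z ^ (n + 2))"
  shows "g \<in> SP_p \<alpha> \<beta>"
proof -
  define S where "S = (\<Sum>n. norm (b n))"
  define T where "T = (\<Sum>n. real (n + 1) * norm (b n))"
  have summ_b: "summable (\<lambda>n. norm (b n))"
    by (rule summable_comparison_test[OF _ summ]) (auto intro!: exI[of _ 0] simp: algebra_simps)
  have summ_T: "summable (\<lambda>n. real (n + 1) * norm (b n))"
    by (rule summable_comparison_test[OF _ summ]) (auto intro!: exI[of _ 0] mult_right_mono)
  have "S \<ge> 0" "T \<ge> 0"
    unfolding S_def T_def by (intro suminf_nonneg summ_b summ_T; simp)+
  \<comment> \<open>Termwise, \<open>2 (n + 1) + cos \<alpha> - \<beta>\<close> is at most
    \<open>2 (n + 2) - cos \<alpha> - \<beta>\<close>, because \<open>cos \<alpha>\<close> is at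
    most 1. This is the form that matches the estimates of \<open>v\<close> by \<open>T\<close> and
    of \<open>u\<close> by \<open>S\<close> below.\<close>
  have ST: "2 * T + (cos \<alpha> - \<beta>) * S \<le> cos \<alpha> - \<beta>"
  proof -
    have "2 * T + (cos \<alpha> - \<beta>) * S
        = (\<Sum>n. 2 * (real (n + 1) * norm (b n)) + (cos \<alpha> - \<beta>) * norm (b n))"
      unfolding S_def T_def
      by (simp only: suminf_mult[OF summ_T] suminf_mult[OF summ_b]
          suminf_add[OF summable_mult[OF summ_T] summable_mult[OF summ_b], symmetric])
    also have "\<dots> \<le> (\<Sum>n. (2 * real (n + 2) - cos \<alpha> - \<beta>) * norm (b n))"
    proof (rule suminf_le)
      show "2 * (real (n + 1) * norm (b n)) + (cos \<alpha> - \<beta>) * norm (b n)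
          \<le> (2 * real (n + 2) - cos \<alpha> - \<beta>) * norm (b n)" for n
      proof -
        have "(2 * real (n + 1) + (cos \<alpha> - \<beta>)) * norm (b n)
            \<le> (2 * real (n + 2) - cos \<alpha> - \<beta>) * norm (b n)"
          using cos_le_one[of \<alpha>] by (intro mult_right_mono) auto
        then show ?thesis by (simp add: algebra_simps)
      qed
      show "summable (\<lambda>n. 2 * (real (n + 1) * norm (b n)) + (cos \<alpha> - \<beta>) * norm (b n))"
        by (intro summable_add summable_mult summ_T summ_b)
      have "summable (\<lambda>n. 2 * (real (n + 2) * norm (b n)) - (cos \<alpha> + \<beta>) * norm (b n))"
        by (intro summable_diff summable_mult summ summ_b)
      then show "summable (\<lambda>n. (2 * real (n + 2) - cos \<alpha> - \<beta>) * norm (b n))"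
        by (simp add: algebra_simps)
    qed
    also note le
    finally show ?thesis .
  qed
  have deriv_g: "(g has_field_derivative (1 + (\<Sum>n. of_nat (n + 2) * b n * z ^ (n + 1)))) (at z)"
    if "norm z < 1" for z
    using has_field_derivative_tail_series[OF summ_b that] by (simp add: g[abs_def])
  have "g \<in> class_A"
  proof -
    have "g holomorphic_on ball 0 1"
      unfolding holomorphic_on_open[OF open_ball]
    proof
      fix z :: complex assume "z \<in> ball 0 1"
      then have "norm z < 1" by simp
      from deriv_g[OF this] show "\<exists>g'. (g has_field_derivative g') (at z)" by blast
    qed
    moreover have "g 0 = 0" by (simp add: g)
    moreover have "deriv g 0 = 1"
      using DERIV_imp_deriv[OF deriv_g[of 0]] by simp
    ultimately show ?thesis by (simp add: class_A_def)
  qed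
  moreover have "Re (exp (- (\<i> * of_real \<alpha>)) * log_quot g z) > norm (log_quot g z - 1) + \<beta>"
    if z: "z \<in> ball 0 1" for z
  proof -
    define r where "r = norm z"
    have r: "0 \<le> r" "r < 1" using z by (auto simp: r_def)
    have zn: "norm z ^ k \<le> 1" for k
      using r by (simp add: r_def power_le_one)
    have s1: "summable (\<lambda>n. norm (b n * z ^ (n + 1)))"
      by (rule summable_comparison_test[OF _ summ_b])
         (auto intro!: exI[of _ 0] mult_left_le zn simp: norm_mult norm_power simp del: power_Suc)
    have s2: "summable (\<lambda>n. norm (of_nat (n + 2) * b n * z ^ (n + 1)))"
      by (rule summable_comparison_test[OF _ summ])
         (auto intro!: exI[of _ 0] mult_left_le zn simp: norm_mult norm_power
           simp del: power_Suc of_nat_Suc)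
    \<comment> \<open>With these, \<open>g z = z (1 + u)\<close> and the derivative is
      \<open>1 + u + v\<close>, so the logarithmic quotient minus 1 is
      \<open>v / (1 + u)\<close>.\<close>
    define u where "u = (\<Sum>n. b n * z ^ (n + 1))"
    define v where "v = (\<Sum>n. of_nat (n + 1) * b n * z ^ (n + 1))"
    have g_eq: "g z = z * (1 + u)"
      unfolding g u_def distrib_left suminf_mult[OF summable_norm_cancel[OF s1], symmetric]
      by (simp add: mult_ac)
    have uv: "1 + (\<Sum>n. of_nat (n + 2) * b n * z ^ (n + 1)) = 1 + u + v"
    proof -
      have "v = (\<Sum>n. of_nat (n + 2) * b n * z ^ (n + 1) - b n * z ^ (n + 1))"
        unfolding v_def by (intro suminf_cong) (simp add: algebra_simps)
      also have "\<dots> = (\<Sum>n. of_nat (n + 2) * b n * z ^ (n + 1)) - u"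
        unfolding u_def
        by (rule suminf_diff[OF summable_norm_cancel[OF s2] summable_norm_cancel[OF s1], symmetric])
      finally show ?thesis by simp
    qed
    have power_le: "r ^ (n + 1) \<le> r" for n
      using r by (simp add: mult_left_le power_le_one)
    have u_le: "norm u \<le> r * S"
    proof -
      have "norm u \<le> (\<Sum>n. r * norm (b n))"
        unfolding u_def
      proof (rule norm_suminf_le)
        show "norm (b n * z ^ (n + 1)) \<le> r * norm (b n)" for n
          using mult_right_mono[OF power_le[of n] norm_ge_zero[of "b n"]]
          by (simp add: norm_mult norm_power r_def mult_ac)
      qed (intro summable_mult summ_b)
      then show ?thesis by (simp add: S_def suminf_mult[OF summ_b])
    qed
    have v_le: "norm v \<le> r * T"
    proof -
      have "norm v \<le> (\<Sum>n. r * (real (n + 1) * norm (b n)))"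
        unfolding v_def
      proof (rule norm_suminf_le)
        show "norm (of_nat (n + 1) * b n * z ^ (n + 1)) \<le> r * (real (n + 1) * norm (b n))" for n
          using mult_right_mono[OF power_le[of n], of "real (n + 1) * norm (b n)"]
          by (simp only: norm_mult norm_power norm_of_nat r_def mult_ac) simp
      qed (intro summable_mult summ_T)
      then show ?thesis by (simp only: T_def suminf_mult[OF summ_T])
    qed
    \<comment> \<open>Both series carry at least one factor \<open>z\<close>, and
      \<open>r < 1\<close> together with \<open>\<beta> < cos \<alpha>\<close> makes the inequality
      strict. It also forces \<open>norm u < 1\<close>, hence \<open>1 + u\<close> is nonzero and
      \<open>g\<close> has no zero in the disc besides the origin.\<close>
    have key: "2 * norm v < (cos \<alpha> - \<beta>) * (1 - norm u)"
    proof -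
      have "2 * norm v + (cos \<alpha> - \<beta>) * norm u \<le> 2 * (r * T) + (cos \<alpha> - \<beta>) * (r * S)"
        using u_le v_le \<beta> by (intro add_mono mult_left_mono) auto
      also have "\<dots> = r * (2 * T + (cos \<alpha> - \<beta>) * S)"
        by (simp add: algebra_simps)
      also have "\<dots> \<le> r * (cos \<alpha> - \<beta>)"
        using ST r by (intro mult_left_mono)
      also have "\<dots> < 1 * (cos \<alpha> - \<beta>)"
        using r \<beta> by (intro mult_strict_right_mono) auto
      finally show ?thesis by (simp add: algebra_simps)
    qed
    then have "0 < (cos \<alpha> - \<beta>) * (1 - norm u)"
      using norm_ge_zero[of v] by linarith
    then have u1: "norm u < 1"
      using \<beta> by (simp add: zero_less_mult_iff)
    have "1 - norm u \<le> norm (1 + u)"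
      using norm_triangle_ineq2[of 1 "- u"] by simp
    then have "1 + u \<noteq> 0"
      using u1 by auto
    \<comment> \<open>At \<open>z = 0\<close> both sides vanish: \<open>log_quot\<close> is 1 there
      by convention, and each term of \<open>v\<close> contains a positive power of
      \<open>z\<close>.\<close>
    have quot: "log_quot g z - 1 = v / (1 + u)"
    proof (cases "z = 0")
      case True
      then show ?thesis by (simp add: log_quot_def v_def)
    next
      case False
      have "deriv g z = 1 + u + v"
        using DERIV_imp_deriv[OF deriv_g] z uv by simp
      then have "log_quot g z = (1 + u + v) / (1 + u)"
        using False by (simp add: log_quot_def g_eq)
      then show ?thesis
        using \<open>1 + u \<noteq> 0\<close> by (simp add: add_divide_distrib[of "1 + u"])
    qed
    have small: "2 * norm (log_quot g z - 1) < cos \<alpha> - \<beta>"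
    proof -
      have "2 * norm v < (cos \<alpha> - \<beta>) * norm (1 + u)"
        using key \<beta> \<open>1 - norm u \<le> norm (1 + u)\<close>
        by (meson diff_gt_0_iff_gt less_le_trans mult_left_mono order_less_imp_le)
      then show ?thesis
        using \<open>1 + u \<noteq> 0\<close> by (simp add: quot norm_divide divide_simps)
    qed
    let ?w = "log_quot g z - 1" and ?e = "exp (- (\<i> * of_real \<alpha>))"
    have "Re (?e * log_quot g z) = cos \<alpha> + Re (?e * ?w)"
      by (simp add: Re_exp algebra_simps)
    moreover have "- norm ?w \<le> Re (?e * ?w)"
      using abs_Re_le_cmod[of "?e * ?w"] by (simp add: norm_mult norm_exp_eq_Re)
    ultimately show ?thesis using small by linarith
  qed
  ultimately show ?thesis by (simp add: SP_p_def)
qed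

section \<open>Negative coefficients and the inclusion theorem\<close>

text \<open>By uniqueness of power series, the representation in \<open>class_T\<close> determines
  the Taylor coefficients. The witness is shifted by 2 because the sequence in
  \<open>class_T\<close> is indexed by the exponent.\<close>

lemma class_T_coeff:
  assumes "f \<in> class_T"
  obtains a :: "nat \<Rightarrow> complex"
  where "\<And>n. fps_nth (fps_expansion f 0) (n + 2) = - of_real (norm (a n))"
proof -
  obtain a :: "nat \<Rightarrow> complex" where a: "\<And>z. z \<in> ball 0 1 \<Longrightarrow>
      (\<lambda>n. of_real (norm (a (n + 2))) * z ^ (n + 2)) sums (z - f z)"
    using assms unfolding class_T_def by blast
  define F :: "complex fps" where
    "F = Abs_fps (\<lambda>n. if n < 2 then of_nat n else - of_real (norm (a n)))"
  have "(\<lambda>n. fps_nth F n * z ^ n) sums f z" if z: "z \<in> ball 0 1" for z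
  proof -
    have "(\<lambda>n. fps_nth F (n + 2) * z ^ (n + 2)) sums (f z - (\<Sum>n<2. fps_nth F n * z ^ n))"
      using sums_minus[OF a[OF z]] by (simp add: F_def numeral_2_eq_2)
    then show ?thesis by (subst (asm) sums_iff_shift) simp
  qed
  then have "\<forall>\<^sub>F z in nhds 0. (\<lambda>n. fps_nth F n * z ^ n) sums f z"
    using eventually_nhds_in_open[of "ball 0 1" "0 :: complex"] by (auto elim!: eventually_mono)
  then have "fps_expansion f 0 = F"
    by (intro fps_expansion_eqI has_fps_expansionI)
  then show ?thesis
    by (intro that[of "\<lambda>n. a (n + 2)"]) (simp add: F_def)
qed

text \<open>Membership in \<open>TSP_p\<close> is stated for \<open>f\<close> in
  \<open>class_T\<close>: the multipliers are positive, so the operator keeps the argument of each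
  nonzero coefficient, and \<open>class_R\<close> does not make these coefficients negative.\<close>

theorem theorem3p1:
  fixes \<alpha> \<beta> m q A B :: real and \<tau> :: complex and f :: "complex \<Rightarrow> complex"
  assumes "\<bar>\<alpha>\<bar> < pi / 2" and "0 \<le> \<beta>" and "\<beta> < 1"
    and "m > 1" and "0 < q" and "q < 1"
    and "\<tau> \<noteq> 0" and "-1 \<le> B" and "B < A" and "A \<le> 1"
    and "f \<in> class_R \<tau> A B"
    and "(A - B) * norm \<tau> *
          (2 * (1 - (1 - q) powr m) -
           (cos \<alpha> + \<beta>) / (q * (m - 1)) *
             ((1 - q) - (1 - q) powr m - q * (m - 1) * (1 - q) powr m))
         \<le> cos \<alpha> - \<beta>"
  shows "pascal_op q m f \<in> SP_p \<alpha> \<beta> \<and>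
         (f \<in> class_T \<longrightarrow> pascal_op q m f \<in> TSP_p \<alpha> \<beta>)"
proof -
  define P where "P n = pascal_binom m (n + 2) * q ^ (n + 1) * (1 - q) powr m" for n
  define c where "c n = fps_nth (fps_expansion f 0) (n + 2)" for n
  define b where "b n = of_real (P n) * c n" for n
  define D where "D = (A - B) * norm \<tau>"
  have D: "D > 0" using assms by (simp add: D_def)
  have P: "P n > 0" for n
    using assms by (auto simp: P_def pascal_binom_def intro!: mult_pos_pos divide_pos_pos pochhammer_pos)
  have c: "real (n + 2) * norm (c n) \<le> D" for n
    unfolding c_def D_def using assms by (intro norm_coeff_class_R)
  have g: "pascal_op q m f z = z + (\<Sum>n. b n * z ^ (n + 2))" for z
    by (simp add: pascal_op_def b_def c_def P_def)
  have P_sums: "P sums (1 - (1 - q) powr m)"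
    unfolding P_def using assms by (intro pascal_weights_sums)
  have P_div_sums: "(\<lambda>n. P n / real (n + 2)) sums
      (((1 - q) - (1 - q) powr m - q * (m - 1) * (1 - q) powr m) / (q * (m - 1)))"
    unfolding P_def using assms by (intro pascal_weights_div_sums) auto
  let ?K = "\<lambda>n. 2 * real (n + 2) - cos \<alpha> - \<beta>"
  have K: "?K n > 0" for n
  proof -
    have "2 * real (n + 2) \<ge> 4" by simp
    then show ?thesis using cos_le_one[of \<alpha>] assms(3) by linarith
  qed
  \<comment> \<open>This is the majorant of \<open>?K n * norm (b n)\<close> obtained from the
    coefficient bound. Dividing \<open>?K n\<close> by \<open>n + 2\<close> splits it into multiples
    of \<open>P n\<close> and \<open>P n / real (n + 2)\<close>, whose sums are known, and the total
    \<open>L\<close> is the left-hand side of the hypothesis.\<close>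
  define X where "X n = D * (?K n * (P n / real (n + 2)))" for n
  have X_pos: "X n > 0" for n
    unfolding X_def using D K P by (intro mult_pos_pos divide_pos_pos) auto
  have X_eq: "X n = D * (2 * P n - (cos \<alpha> + \<beta>) * (P n / real (n + 2)))" for n
    by (simp add: X_def field_simps)
  define L where "L = D * (2 * (1 - (1 - q) powr m) - (cos \<alpha> + \<beta>) *
    (((1 - q) - (1 - q) powr m - q * (m - 1) * (1 - q) powr m) / (q * (m - 1))))"
  have X_sums: "X sums L"
    unfolding X_eq L_def by (intro sums_mult sums_diff P_sums P_div_sums)
  have L_le: "L \<le> cos \<alpha> - \<beta>"
    using assms(12) by (simp add: L_def D_def)
  have "0 < suminf X"
    using X_pos by (intro suminf_pos sums_summable[OF X_sums])
  then have \<beta>: "\<beta> < cos \<alpha>"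
    using L_le sums_unique[OF X_sums] by simp
  have b_le: "real (n + 2) * norm (b n) \<le> D * P n" for n
    using mult_left_mono[OF c[of n], of "P n"] P[of n]
    by (simp add: b_def norm_mult mult_ac)
  have summ: "summable (\<lambda>n. real (n + 2) * norm (b n))"
    by (rule summable_comparison_test[OF _ summable_mult[OF sums_summable[OF P_sums], of D]])
       (use b_le in \<open>auto intro!: exI[of _ 0] simp del: of_nat_Suc of_nat_add\<close>)
  have term_le: "?K n * norm (b n) \<le> X n" for n
  proof -
    have "norm (b n) \<le> D * P n / real (n + 2)"
      using b_le[of n] by (simp add: field_simps)
    from mult_left_mono[OF this, of "?K n"] K[of n] show ?thesis
      by (simp add: X_def mult_ac)
  qed
  have "(\<Sum>n. ?K n * norm (b n)) \<le> (\<Sum>n. X n)"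
  proof (rule suminf_le[OF term_le])
    show "summable X" using X_sums by (rule sums_summable)
    then show "summable (\<lambda>n. ?K n * norm (b n))"
      by (rule summable_comparison_test[rotated])
         (use term_le K in \<open>auto intro!: exI[of _ 0] simp: abs_mult abs_of_pos\<close>)
  qed
  then have le: "(\<Sum>n. ?K n * norm (b n)) \<le> cos \<alpha> - \<beta>"
    using L_le sums_unique[OF X_sums] by simp
  have SP: "pascal_op q m f \<in> SP_p \<alpha> \<beta>"
    by (rule SP_p_of_coeff_sum[OF \<beta> summ le g])
  moreover have "pascal_op q m f \<in> class_T" if T: "f \<in> class_T"
  proof -
    obtain a :: "nat \<Rightarrow> complex" where a: "\<And>n. c n = - of_real (norm (a n))"
      using class_T_coeff[OF T] unfolding c_def by metis
    have summ_b: "summable (\<lambda>n. norm (b n))"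
      by (rule summable_comparison_test[OF _ summ]) (auto intro!: exI[of _ 0] simp: algebra_simps)
    have "(\<lambda>n. of_real (norm (b n)) * z ^ (n + 2)) sums (z - pascal_op q m f z)"
      if z: "z \<in> ball 0 1" for z
    proof -
      have "norm z ^ k \<le> 1" for k
        using z by (simp add: power_le_one)
      then have "norm (b n * z ^ (n + 2)) \<le> norm (b n)" for n
        by (simp only: norm_mult norm_power mult_left_le norm_ge_zero)
      then have "summable (\<lambda>n. norm (b n * z ^ (n + 2)))"
        by (intro summable_norm_comparison_test[OF _ summ_b] exI[of _ 0] allI impI)
      then have "(\<lambda>n. - (b n * z ^ (n + 2))) sums - (\<Sum>n. b n * z ^ (n + 2))"
        by (rule sums_minus[OF summable_sums[OF summable_norm_cancel]])
      \<comment> \<open>Since \<open>c n\<close> is minus a norm and \<open>P n\<close> is positive,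
        \<open>b n\<close> is real and nonpositive, so \<open>- b n\<close> is its norm.\<close>
      moreover have "- (b n * z ^ (n + 2)) = of_real (norm (b n)) * z ^ (n + 2)" for n
        using P[of n] by (simp add: b_def a norm_mult)
      ultimately show ?thesis by (simp add: g)
    qed
    \<comment> \<open>The sequence required by \<open>class_T\<close> is indexed by the exponent, so
      \<open>b\<close> is shifted back by 2; only values at \<open>n + 2\<close> are used, where the
      subtraction is exact.\<close>
    then have "\<exists>a :: nat \<Rightarrow> complex. \<forall>z\<in>ball 0 1.
        (\<lambda>n. of_real (norm (a (n + 2))) * z ^ (n + 2)) sums (z - pascal_op q m f z)"
      by (intro exI[of _ "\<lambda>n. b (n - 2)"]) (simp del: power_Suc)
    then show ?thesis
      using SP by (simp add: class_T_def SP_p_def)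
  qed
  ultimately show ?thesis by (simp add: TSP_p_def)
qed

end
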